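(* Let $k$ be a positive integer and let $D$ be a digraph that has a spanning out-tree. If $D$ contains no subdivision of $C(k,1,1,1)$, then $\chi(D)\le 18k$.
   Context: All graphs are finite and simple (no loops, no multiple edges). A digraph is obtained from such a graph by giving exactly one orientation to each edge (so there are no loops, no parallel arcs and no pairs of opposite arcs). The chromatic number $\chi(D)$ of a digraph $D$ is the chromatic number of its underlying graph. An out-tree of $D$ is a sub-digraph of $D$ that is a rooted oriented tree: it has one vertex of in-degree $0$ (the root $r$), all its other vertices have in-degree $1$, and each vertex $x$ of it is reached from $r$ by a unique directed path. It is spanning if it contains all vertices of $D$. For positive integers $k_1,k_2,k_3,k_4$, $C(k_1,k_2,k_3,k_4)$ denotes the oriented cycle with four blocks (a block is a maximal directed subpath of the oriented cycle) whose lengths are, in cyclic order, $k_1,k_2,k_3,k_4$. That is, for distinct vertices $x_1,x_2,y_1,y_2$ it is the union of four pairwise internally disjoint directed paths: from $x_1$ to $y_1$ of length $k_1$, from $x_2$ to $y_1$ of length $k_2$, from $x_2$ to $y_2$ of length $k_3$, and from $x_1$ to $y_2$ of length $k_4$. A subdivision of a digraph $F$ is a digraph obtained from $F$ by replacing each arc $(x,y)$ of $F$ by a directed path from $x$ to $y$ of length at least $1$ (these paths being pairwise internally disjoint, with new internal vertices). "Contains" means contains as a (not necessarily induced) sub-digraph. *)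

theory Defs
  imports "Graph_Theory.Graph_Theory"
begin

text \<open>
  A digraph here is an orientation of a finite simple graph, i.e. a finite loopless digraph whose
  arcs are ordered pairs of vertices, with no two opposite arcs.
\<close>

locale oriented_graph = pair_digraph +
  assumes no_opposite_arcs: "(u, v) \<in> parcs G \<Longrightarrow> (v, u) \<notin> parcs G"


text \<open>Undirected graphs are symmetric digraphs, as usual in \<^theory>\<open>Graph_Theory.Digraph\<close>.\<close>

definition proper_coloring :: "'a pair_pre_digraph \<Rightarrow> nat \<Rightarrow> ('a \<Rightarrow> nat) \<Rightarrow> bool" where
  "proper_coloring G n c \<longleftrightarrow>
     (\<forall>v \<in> pverts G. c v < n) \<and> (\<forall>(u, v) \<in> parcs G. c u \<noteq> c v)"

definition chromatic_number :: "'a pair_pre_digraph \<Rightarrow> nat" where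
  "chromatic_number G = (LEAST n. \<exists>c. proper_coloring G n c)"

definition digraph_chromatic_number :: "'a pair_pre_digraph \<Rightarrow> nat" where
  "digraph_chromatic_number D = chromatic_number (mk_symmetric D)"


definition out_tree :: "'a pair_pre_digraph \<Rightarrow> 'a \<Rightarrow> bool" where
  "out_tree T r \<longleftrightarrow>
     r \<in> pverts T \<and> in_degree T r = 0 \<and>
     (\<forall>v \<in> pverts T - {r}. in_degree T v = 1) \<and>
     (\<forall>v \<in> pverts T. \<exists>!p. pre_digraph.apath T r p v)"

definition has_spanning_out_tree :: "'a pair_pre_digraph \<Rightarrow> bool" where
  "has_spanning_out_tree D \<longleftrightarrow>
     (\<exists>T r. spanning (with_proj T) (with_proj D) \<and> out_tree T r)"


text \<open>
  The cycle with four blocks, for positive lengths, on the vertices \<open>0, \<dots>, k1 + k2 + k3 + k4 - 1\<close>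
  taken in cyclic order. In the usual notation for the ends of the blocks,
  \<open>x\<^sub>1 = 0\<close>, \<open>y\<^sub>1 = k1\<close>, \<open>x\<^sub>2 = k1 + k2\<close> and \<open>y\<^sub>2 = k1 + k2 + k3\<close>; the four vertex lists are the directed
  paths from \<open>x\<^sub>1\<close> to \<open>y\<^sub>1\<close>, from \<open>x\<^sub>2\<close> to \<open>y\<^sub>1\<close>, from \<open>x\<^sub>2\<close> to \<open>y\<^sub>2\<close> and from \<open>x\<^sub>1\<close> to \<open>y\<^sub>2\<close>.
\<close>

definition four_block_cycle :: "nat \<Rightarrow> nat \<Rightarrow> nat \<Rightarrow> nat \<Rightarrow> nat pair_pre_digraph" where
  "four_block_cycle k1 k2 k3 k4 =
     \<lparr> pverts = {0 ..< k1 + k2 + k3 + k4},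
       parcs = set (vwalk_arcs [0 ..< k1 + 1])
             \<union> set (vwalk_arcs (rev [k1 ..< k1 + k2 + 1]))
             \<union> set (vwalk_arcs [k1 + k2 ..< k1 + k2 + k3 + 1])
             \<union> set (vwalk_arcs (0 # rev [k1 + k2 + k3 ..< k1 + k2 + k3 + k4])) \<rparr>"


text \<open>
  \<open>H\<close> is a subdivision of \<open>F\<close> (up to isomorphism): \<open>f\<close> embeds the vertices of \<open>F\<close> into \<open>H\<close>, and
  \<open>P e\<close> is the directed path, given by its list of arcs, that replaces the arc \<open>e\<close> of \<open>F\<close>.
  The notion in \<^theory>\<open>Graph_Theory.Subdivision\<close> is for symmetric digraphs only.
\<close>

definition is_subdivision_of :: "'a pair_pre_digraph \<Rightarrow> 'b pair_pre_digraph \<Rightarrow> bool" where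
  "is_subdivision_of H F \<longleftrightarrow>
     (\<exists>(f :: 'b \<Rightarrow> 'a) (P :: 'b \<times> 'b \<Rightarrow> ('a \<times> 'a) awalk).
        inj_on f (pverts F) \<and>
        (\<forall>(x, y) \<in> parcs F.
           pre_digraph.apath H (f x) (P (x, y)) (f y) \<and> length (P (x, y)) \<ge> 1) \<and>
        (\<forall>e \<in> parcs F. set (pre_digraph.inner_verts H (P e)) \<inter> f ` pverts F = {}) \<and>
        (\<forall>e \<in> parcs F. \<forall>e' \<in> parcs F. e \<noteq> e' \<longrightarrow>
           set (pre_digraph.inner_verts H (P e)) \<inter> set (pre_digraph.inner_verts H (P e')) = {}) \<and>
        pverts H = f ` pverts F \<union> (\<Union>e \<in> parcs F. set (pre_digraph.inner_verts H (P e))) \<and>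
        parcs H = (\<Union>e \<in> parcs F. set (P e)))"

definition contains_subdivision :: "'a pair_pre_digraph \<Rightarrow> 'b pair_pre_digraph \<Rightarrow> bool" where
  "contains_subdivision D F \<longleftrightarrow>
     (\<exists>H. subgraph (with_proj H) (with_proj D) \<and> is_subdivision_of H F)"

end

theory Submission
  imports Defs
begin

text \<open>
  Choose levels and parents forming a spanning out-tree that maximizes the sum of the levels. Then
  every arc \<open>(x, y)\<close> either goes to a strictly larger level or has \<open>y\<close> as an ancestor of \<open>x\<close>,
  since otherwise reattaching \<open>y\<close> below \<open>x\<close> would increase that sum. Split the vertices into
  \<open>k\<close> classes according to the level modulo \<open>k\<close>: a tree path between two levels of one class has
  length at least \<open>k\<close>, so it can serve as the long block of a cycle. A set \<open>W\<close> of vertices of one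
  class spans at most \<open>3|W|\<close> arcs from an ancestor to a descendant, \<open>3|W|\<close> arcs from a descendant
  to an ancestor, and \<open>2|W|\<close> other arcs: deleting at each vertex, once or twice, the arc whose
  other end is lowest leaves arcs with spare neighbours at lower levels, and too many of these
  close up with tree paths to a cycle with four blocks. Hence each class is 16-degenerate, and 18
  colours suffice for it.
\<close>

section \<open>Assembling the four-block cycle\<close>

text \<open>Paths are vertex lists over a bare arc relation, so that disjointness is a condition on
  \<open>set p\<close> and tree paths can be built without a graph structure. One-vertex lists are
  allowed because a tree path may be trivial.\<close>

definition dpath :: "'a rel \<Rightarrow> 'a \<Rightarrow> 'a list \<Rightarrow> 'a \<Rightarrow> bool" where
  "dpath A u p v \<longleftrightarrow> p \<noteq> [] \<and> hd p = u \<and> last p = v \<and> distinct p \<and> set (vwalk_arcs p) \<subseteq> A"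

lemma set_vwalk_arcs_conv_nth:
  "set (vwalk_arcs p) = {(p ! i, p ! Suc i) | i. Suc i < length p}"
proof (induction p rule: vwalk_arcs.induct)
  case (3 x y xs)
  have "{((x # y # xs) ! i, (x # y # xs) ! Suc i) | i. Suc i < length (x # y # xs)}
    = insert (x, y) {((y # xs) ! i, (y # xs) ! Suc i) | i. Suc i < length (y # xs)}" (is "?L = ?R")
  proof
    show "?L \<subseteq> ?R"
    proof
      fix e assume "e \<in> ?L"
      then obtain i where "e = ((x # y # xs) ! i, (x # y # xs) ! Suc i)" "Suc i < length (x # y # xs)"
        by blast
      then show "e \<in> ?R" by (cases i) auto
    qed
    show "?R \<subseteq> ?L" by (auto 4 4 intro: exI[of _ 0] exI[of _ "Suc _"])
  qed
  with 3 show ?case by simp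
qed auto

lemma dpathD:
  assumes "dpath A u p v"
  shows "p \<noteq> []" "u \<in> set p" "v \<in> set p" "distinct p" "hd p = u" "last p = v" "set (vwalk_arcs p) \<subseteq> A"
  using assms by (auto simp: dpath_def)

lemma dpath_length:
  assumes "dpath A u p v" "u \<noteq> v"
  shows "length p \<ge> 2"
  using assms by (cases p rule: vwalk_arcs.cases) (auto simp: dpath_def)

lemma dpath_arc: "(u, v) \<in> A \<Longrightarrow> u \<noteq> v \<Longrightarrow> dpath A u [u, v] v"
  by (simp add: dpath_def)

lemma dpath_snoc: "dpath A u p v \<Longrightarrow> (v, w) \<in> A \<Longrightarrow> w \<notin> set p \<Longrightarrow> dpath A u (p @ [w]) w"
  by (auto simp: dpath_def vwalk_arcs_append)

lemma dpath_Cons: "dpath A v p w \<Longrightarrow> (u, v) \<in> A \<Longrightarrow> u \<notin> set p \<Longrightarrow> dpath A u (u # p) w"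
  by (auto simp: dpath_def)

section \<open>From vertex lists to arc walks\<close>

lemma vwalk_arcs_subset: "set (vwalk_arcs p) \<subseteq> set p \<times> set p"
  by (induction p rule: vwalk_arcs.induct) auto

lemma map_fst_vwalk_arcs: "map fst (vwalk_arcs p) = butlast p"
  by (induction p rule: vwalk_arcs.induct) auto

lemma pawalk_verts_vwalk_arcs: "p \<noteq> [] \<Longrightarrow> pawalk_verts (hd p) (vwalk_arcs p) = p"
  by (induction p rule: vwalk_arcs.induct) auto

lemma pcas_vwalk_arcs: "p \<noteq> [] \<Longrightarrow> pcas (hd p) (vwalk_arcs p) (last p)"
  by (induction p rule: vwalk_arcs.induct) auto

lemma pcas_imp_rtrancl: "pcas u p v \<Longrightarrow> set p \<subseteq> A \<Longrightarrow> (u, v) \<in> A\<^sup>*"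
  by (induction u p v rule: pcas.induct) (auto intro: converse_rtrancl_into_rtrancl)

lemma apath_vwalk_arcs:
  assumes "dpath (parcs H) u p v" "u \<in> pverts H"
  shows "pre_digraph.apath (with_proj H) u (vwalk_arcs p) v"
  using assms pawalk_verts_vwalk_arcs[of p] pcas_vwalk_arcs[of p]
  by (auto simp: dpath_def pre_digraph.apath_def pre_digraph.awalk_def cas_with_proj_eq
      awalk_verts_with_proj_eq)

lemma inner_verts_vwalk_arcs:
  "pre_digraph.inner_verts (with_proj H) (vwalk_arcs p) = butlast (tl p)"
  by (simp add: inner_verts_with_proj_def map_fst_vwalk_arcs butlast_tl)

lemma set_butlast_tl:
  assumes "dpath A u p v" "u \<noteq> v"
  shows "set (butlast (tl p)) = set p - {u, v}"
proof -
  obtain q where "p = u # q" using assms by (cases p) (auto simp: dpath_def)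
  moreover with assms have "q \<noteq> []" "last q = v" by (auto simp: dpath_def split: if_splits)
  ultimately obtain q' where "p = u # q' @ [v]" by (metis append_butlast_last_id)
  then show ?thesis using assms by (auto simp: dpath_def)
qed

section \<open>The pattern C(k,1,1,1) and its subdivisions\<close>

lemma four_block_cycle_conv:
  assumes "k \<ge> 1"
  shows "pverts (four_block_cycle k 1 1 1) = {..<k + 3}"
    and "parcs (four_block_cycle k 1 1 1)
      = {(i, Suc i) | i. i < k} \<union> {(k + 1, k), (k + 1, k + 2), (0, k + 2)}"
proof -
  have "[k..<k + 1 + 1] = [k, k + 1]" "[k + 1..<k + 1 + 1 + 1] = [k + 1, k + 2]"
    "[k + 1 + 1..<k + 1 + 1 + 1] = [k + 2]"
    by (simp_all add: upt_rec)
  moreover have "set (vwalk_arcs [0..<k + 1]) = {(i, Suc i) | i. i < k}"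
    unfolding set_vwalk_arcs_conv_nth by (force simp del: upt_Suc)
  ultimately show "pverts (four_block_cycle k 1 1 1) = {..<k + 3}"
    "parcs (four_block_cycle k 1 1 1)
      = {(i, Suc i) | i. i < k} \<union> {(k + 1, k), (k + 1, k + 2), (0, k + 2)}"
    unfolding four_block_cycle_def by auto
qed

text \<open>Every later contradiction ends here. The three blocks of length 1 may be stretched to
  any length and the first to any length of at least \<open>k\<close>. As \<open>length\<close>
  counts vertices, \<open>length p1 > k\<close> means at least \<open>k\<close> arcs.\<close>

lemma contains_four_block_cycle:
  assumes wf: "pair_wf_digraph D" and k: "k \<ge> 1"
    and p1: "dpath (parcs D) x1 p1 y1" and p2: "dpath (parcs D) x2 p2 y1"
    and p3: "dpath (parcs D) x2 p3 y2" and p4: "dpath (parcs D) x1 p4 y2"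
    and long: "length p1 > k"
    and ne: "x1 \<noteq> x2" "y1 \<noteq> y2" "x1 \<noteq> y1" "x1 \<noteq> y2" "x2 \<noteq> y1" "x2 \<noteq> y2"
    and disj: "set p1 \<inter> set p2 \<subseteq> {y1}" "set p2 \<inter> set p3 \<subseteq> {x2}" "set p3 \<inter> set p4 \<subseteq> {y2}"
      "set p1 \<inter> set p4 \<subseteq> {x1}" "set p1 \<inter> set p3 = {}" "set p2 \<inter> set p4 = {}"
  shows "contains_subdivision D (four_block_cycle k 1 1 1)"
proof -
  define m where "m = k - 1"
  have km: "k = Suc m" using k by (simp add: m_def)
  define H where "H = \<lparr> pverts = set p1 \<union> set p2 \<union> set p3 \<union> set p4,
    parcs = set (vwalk_arcs p1) \<union> set (vwalk_arcs p2) \<union> set (vwalk_arcs p3) \<union> set (vwalk_arcs p4) \<rparr>"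
  define q where "q = drop m p1"
  \<comment> \<open>The first block has \<open>k\<close> arcs in the pattern; its last arc, from \<open>m\<close> to \<open>k\<close>, absorbs the excess
    length of \<open>p1\<close> and becomes the path \<open>q\<close>.\<close>
  define f where "f i = (if i < k then p1 ! i else if i = k then y1 else if i = k + 1 then x2 else y2)" for i
  define Q where "Q e = (if e = (0, k + 2) then p4 else if e = (k + 1, k) then p2
    else if e = (k + 1, k + 2) then p3 else if e = (m, k) then q else [p1 ! fst e, p1 ! snd e])" for e
  note ds = dpathD[OF p1] dpathD[OF p2] dpathD[OF p3] dpathD[OF p4]
  have x1: "p1 ! 0 = x1" using ds(1,5) by (simp add: hd_conv_nth)
  have lenq: "length q \<ge> 2" using long km by (simp add: q_def)
  have y1_nth: "p1 ! (length p1 - 1) = y1" using ds by (simp add: last_conv_nth)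
  have inj1: "p1 ! i = p1 ! j \<longleftrightarrow> i = j" if "i < length p1" "j < length p1" for i j
    using that ds(4) by (simp add: nth_eq_iff_index_eq)
  have qarcs: "set (vwalk_arcs q) \<subseteq> set (vwalk_arcs p1)"
    unfolding q_def by (metis append_take_drop_id set_vwalk_arcs_append2)
  have q: "dpath (parcs H) (p1 ! m) q y1"
    using ds long km qarcs by (auto simp: dpath_def H_def q_def hd_drop_conv_nth)
  have my1: "p1 ! m \<noteq> y1"
    using y1_nth inj1[of m "length p1 - 1"] long km by auto
  have setq: "set q = {p1 ! i | i. m \<le> i \<and> i < length p1}"
    unfolding q_def set_conv_nth using long km
    by auto (metis add.commute le_add_diff_inverse less_diff_conv)+
  have innerq: "set (butlast (tl q)) = {p1 ! i | i. k \<le> i \<and> i < length p1} - {y1}"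
    unfolding set_butlast_tl[OF q my1] setq using inj1 long km
    by (auto simp: km)
  have p1s: "set p1 = {p1 ! i | i. i < k} \<union> set (butlast (tl q)) \<union> {y1}"
    unfolding innerq using ds(3) long by (auto simp: set_conv_nth) (metis not_less)+
  have p1arcs: "set (vwalk_arcs p1) = {(p1 ! i, p1 ! Suc i) | i. i < m} \<union> set (vwalk_arcs q)"
  proof -
    have "set (vwalk_arcs p1) \<subseteq> {(p1 ! i, p1 ! Suc i) | i. i < m} \<union> set (vwalk_arcs q)"
    proof
      fix e assume "e \<in> set (vwalk_arcs p1)"
      then obtain i where i: "e = (p1 ! i, p1 ! Suc i)" "Suc i < length p1"
        unfolding set_vwalk_arcs_conv_nth by blast
      show "e \<in> {(p1 ! i, p1 ! Suc i) | i. i < m} \<union> set (vwalk_arcs q)"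
      proof (cases "i < m")
        case False
        with i have "e = (q ! (i - m), q ! Suc (i - m))" "Suc (i - m) < length q"
          by (auto simp: q_def)
        then show ?thesis unfolding set_vwalk_arcs_conv_nth[of q] by blast
      qed (use i in auto)
    qed
    moreover have "{(p1 ! i, p1 ! Suc i) | i. i < m} \<subseteq> set (vwalk_arcs p1)"
      unfolding set_vwalk_arcs_conv_nth using long km by auto
    ultimately show ?thesis using qarcs by blast
  qed
  have F: "pverts (four_block_cycle k 1 1 1) = {..<k} \<union> {k, k + 1, k + 2}"
      "parcs (four_block_cycle k 1 1 1)
      = {(i, Suc i) | i. i < m} \<union> {(m, k), (k + 1, k), (k + 1, k + 2), (0, k + 2)}"
    unfolding four_block_cycle_conv[OF k] by (auto simp: km less_Suc_eq)
  have f_simps: "f k = y1" "f (k + 1) = x2" "f (k + 2) = y2" "f m = p1 ! m" "f 0 = x1"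
    "\<And>i. i < m \<Longrightarrow> f i = p1 ! i" "\<And>i. i < m \<Longrightarrow> f (Suc i) = p1 ! Suc i"
    using x1 by (auto simp: f_def km)
  have Q_simps: "Q (m, k) = q" "Q (k + 1, k) = p2" "Q (k + 1, k + 2) = p3" "Q (0, k + 2) = p4"
    "\<And>i. i < m \<Longrightarrow> Q (i, Suc i) = [p1 ! i, p1 ! Suc i]"
    by (auto simp: Q_def km)
  have fimg: "f ` pverts (four_block_cycle k 1 1 1) = {p1 ! i | i. i < k} \<union> {y1, x2, y2}"
    unfolding F(1) image_Un by (auto simp: f_def)
  have in1: "i < k \<Longrightarrow> p1 ! i \<in> set p1" for i using long by auto
  have y1n: "i < k \<Longrightarrow> p1 ! i \<noteq> y1" for i using y1_nth inj1[of i "length p1 - 1"] long by auto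
  have inj: "inj_on f (pverts (four_block_cycle k 1 1 1))"
  proof -
    have "p1 ! i \<noteq> x2" "p1 ! i \<noteq> y2" if "i < k" for i
      using in1[OF that] disj(5) ds by auto
    then show ?thesis
      unfolding inj_on_def F(1) f_def using inj1 y1n not_sym[OF y1n] ne long
      by (auto dest: sym)
  qed
  have innerp: "set (butlast (tl p2)) = set p2 - {x2, y1}" "set (butlast (tl p3)) = set p3 - {x2, y2}"
    "set (butlast (tl p4)) = set p4 - {x1, y2}"
    using set_butlast_tl[OF p2] set_butlast_tl[OF p3] set_butlast_tl[OF p4] ne by auto
  have path: "dpath (parcs H) (f (fst e)) (Q e) (f (snd e)) \<and> length (Q e) \<ge> 2"
    if e: "e \<in> parcs (four_block_cycle k 1 1 1)" for e
  proof -
    from e consider i where "e = (i, Suc i)" "i < m" | "e = (m, k)" | "e = (k + 1, k)"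
      | "e = (k + 1, k + 2)" | "e = (0, k + 2)" unfolding F by auto
    then show ?thesis
    proof cases
      case 1
      then have "p1 ! i \<noteq> p1 ! Suc i" using inj1[of i "Suc i"] long km by auto
      moreover have "(p1 ! i, p1 ! Suc i) \<in> parcs H"
        unfolding H_def using 1 p1arcs by auto
      ultimately show ?thesis using 1 Q_simps(5)[OF 1(2)] f_simps(6,7)[OF 1(2)]
        by (auto simp: dpath_def)
    next
      case 2 then show ?thesis using q lenq Q_simps f_simps by simp
    next
      case 3
      then show ?thesis using p2 dpath_length[OF p2] ne Q_simps f_simps by (auto simp: dpath_def H_def)
    next
      case 4
      then show ?thesis using p3 dpath_length[OF p3] ne Q_simps f_simps by (auto simp: dpath_def H_def)
    next
      case 5
      then show ?thesis using p4 dpath_length[OF p4] ne Q_simps f_simps by (auto simp: dpath_def H_def)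
    qed
  qed
  define I where "I e = set (butlast (tl (Q e)))" for e
  have I: "I (m, k) = set (butlast (tl q))" "I (k + 1, k) = set p2 - {x2, y1}"
    "I (k + 1, k + 2) = set p3 - {x2, y2}" "I (0, k + 2) = set p4 - {x1, y2}"
    "\<And>i. i < m \<Longrightarrow> I (i, Suc i) = {}"
    unfolding I_def Q_simps innerp by (simp_all add: Q_simps)
  \<comment> \<open>The arcs of the first block before \<open>(m, k)\<close> are replaced by single
    arcs. So at most four paths have interior vertices, and both disjointness conditions reduce to
    these.\<close>
  have Ie: "e = (m, k) \<or> e = (k + 1, k) \<or> e = (k + 1, k + 2) \<or> e = (0, k + 2) \<or> I e = {}"
    if "e \<in> parcs (four_block_cycle k 1 1 1)" for e
    using that I(5) unfolding F by auto
  have qsub: "set (butlast (tl q)) \<subseteq> set p1 - {x1, y1}"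
    unfolding innerq using inj1[of _ 0] x1 k long ds(1) by auto
  have mem1: "set (butlast (tl q)) \<inter> {p1 ! i | i. i < k} = {}"
    unfolding innerq using inj1 long by auto
  have H1: "pverts H = f ` pverts (four_block_cycle k 1 1 1) \<union> (\<Union>e \<in> parcs (four_block_cycle k 1 1 1). I e)"
  proof -
    have "(\<Union>e \<in> parcs (four_block_cycle k 1 1 1). I e) = I (m, k) \<union> I (k + 1, k) \<union> I (k + 1, k + 2) \<union> I (0, k + 2)"
      unfolding F(2) using I(5) by auto
    then show ?thesis unfolding I fimg using p1s ds x1 k in1 by (auto simp: H_def)
  qed
  have H2: "parcs H = (\<Union>e \<in> parcs (four_block_cycle k 1 1 1). set (vwalk_arcs (Q e)))"
  proof -
    have "(\<Union>e \<in> {(i, Suc i) | i. i < m}. set (vwalk_arcs (Q e))) = {(p1 ! i, p1 ! Suc i) | i. i < m}"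
      using Q_simps(5) by force
    then show ?thesis unfolding F(2) UN_Un UN_insert UN_empty Q_simps H_def p1arcs by auto
  qed
  have D1: "I e \<inter> f ` pverts (four_block_cycle k 1 1 1) = {}"
    if "e \<in> parcs (four_block_cycle k 1 1 1)" for e
  proof -
    have a: "{p1 ! i | i. i < k} \<subseteq> set p1 - {y1}" using in1 y1n by auto
    show ?thesis using Ie[OF that]
    proof (elim disjE)
      assume "e = (m, k)"
      then show ?thesis unfolding fimg using I(1) mem1 qsub disj(5) ds(16,17) by blast
    next
      assume "e = (k + 1, k)"
      then show ?thesis unfolding fimg using I(2) a disj(1,6) ds(24) by blast
    next
      assume "e = (k + 1, k + 2)"
      then show ?thesis unfolding fimg using I(3) a disj(5) ds(3) by blast
    next
      assume "e = (0, k + 2)"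
      then show ?thesis unfolding fimg using I(4) a disj(4,6) ds(9,10) by blast
    qed auto
  qed
  have D2: "I e \<inter> I e' = {}"
    if "e \<in> parcs (four_block_cycle k 1 1 1)" "e' \<in> parcs (four_block_cycle k 1 1 1)" "e \<noteq> e'" for e e'
  proof -
    have "set (butlast (tl q)) \<inter> I (k + 1, k) = {}" "set (butlast (tl q)) \<inter> I (k + 1, k + 2) = {}"
      "set (butlast (tl q)) \<inter> I (0, k + 2) = {}" "I (k + 1, k) \<inter> I (k + 1, k + 2) = {}"
      "I (k + 1, k) \<inter> I (0, k + 2) = {}" "I (k + 1, k + 2) \<inter> I (0, k + 2) = {}"
      unfolding I using qsub disj by blast+
    with Ie[OF that(1)] Ie[OF that(2)] that(3) I(1) show ?thesis
      by (elim disjE) (auto simp: Int_commute)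
  qed
  have "is_subdivision_of H (four_block_cycle k 1 1 1)"
    unfolding is_subdivision_of_def
  proof (intro exI[of _ f] exI[of _ "\<lambda>e. vwalk_arcs (Q e)"] conjI, goal_cases)
    case 2
    have "f (fst e) \<in> pverts H" if "e \<in> parcs (four_block_cycle k 1 1 1)" for e
    proof -
      have "fst e \<in> pverts (four_block_cycle k 1 1 1)" using that unfolding F by (auto simp: km)
      then show ?thesis unfolding H1 by blast
    qed
    moreover have "length (vwalk_arcs (Q e)) = length (Q e) - 1" for e
      using vwalk_length_simp[of "Q e"] unfolding vwalk_length_def .
    ultimately show ?case using path by (fastforce intro: apath_vwalk_arcs)
  qed (use inj D1 D2 H1 H2 in \<open>simp_all add: inner_verts_vwalk_arcs I_def\<close>)
  moreover have "subgraph (with_proj H) (with_proj D)"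
  proof -
    have "pair_wf_digraph H"
      using vwalk_arcs_subset[of p1] vwalk_arcs_subset[of p2] vwalk_arcs_subset[of p3] vwalk_arcs_subset[of p4]
      by unfold_locales (auto simp: H_def)
    moreover have "parcs H \<subseteq> parcs D" using ds by (auto simp: H_def)
    \<comment> \<open>With at least two vertices, each vertex of the list is an end of one of its
      arcs, and the ends of arcs of \<open>D\<close> are vertices of \<open>D\<close>.\<close>
    moreover have sub: "set p \<subseteq> pverts D" if "set (vwalk_arcs p) \<subseteq> parcs D" "length p \<ge> 2" for p
      using that
    proof (induction p rule: vwalk_arcs.induct)
      case (3 x y xs)
      then show ?case using pair_wf_digraph.wellformed'[OF wf, of x y] by (cases xs) auto
    qed auto
    have "pverts H \<subseteq> pverts D"
      using sub[OF ds(7) dpath_length[OF p1 ne(3)]] sub[OF ds(14) dpath_length[OF p2 ne(5)]]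
        sub[OF ds(21) dpath_length[OF p3 ne(6)]] sub[OF ds(28) dpath_length[OF p4 ne(4)]]
      by (simp add: H_def)
    ultimately show ?thesis using wf
      by (auto simp: subgraph_def wf_digraph_wp_iff compatible_def)
  qed
  ultimately show ?thesis unfolding contains_subdivision_def by blast
qed

section \<open>Sparse graphs\<close>

text \<open>Greedy colouring: remove a vertex with fewer than \<open>n\<close> neighbours, colour
  the rest by induction, and give the vertex a colour that its neighbours miss. The degree condition
  ranges over all nonempty subsets so that the induction inherits it.\<close>

lemma degenerate_coloring:
  fixes E :: "'a rel"
  assumes "finite V" and irr: "\<And>v. v \<in> V \<Longrightarrow> (v, v) \<notin> E"
    and deg: "\<And>W. W \<subseteq> V \<Longrightarrow> W \<noteq> {} \<Longrightarrow> \<exists>v \<in> W. card {u \<in> W. (u, v) \<in> E \<or> (v, u) \<in> E} < n"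
  shows "\<exists>c :: 'a \<Rightarrow> nat. (\<forall>v \<in> V. c v < n) \<and> (\<forall>u \<in> V. \<forall>v \<in> V. (u, v) \<in> E \<longrightarrow> c u \<noteq> c v)"
  using assms
proof (induction V rule: finite_psubset_induct)
  case (psubset V)
  show ?case
  proof (cases "V = {}")
    case False
    with psubset.prems(2)[of V] obtain v where v: "v \<in> V" "card {u \<in> V. (u, v) \<in> E \<or> (v, u) \<in> E} < n"
      by auto
    let ?N = "{u \<in> V. (u, v) \<in> E \<or> (v, u) \<in> E}"
    have "V - {v} \<subset> V" using v by auto
    then have "\<exists>c :: 'a \<Rightarrow> nat. (\<forall>u \<in> V - {v}. c u < n)
        \<and> (\<forall>u \<in> V - {v}. \<forall>w \<in> V - {v}. (u, w) \<in> E \<longrightarrow> c u \<noteq> c w)"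
    proof (rule psubset.IH)
      fix u assume "u \<in> V - {v}"
      then show "(u, u) \<notin> E" using psubset.prems(1) by blast
    next
      fix W assume "W \<subseteq> V - {v}" "W \<noteq> {}"
      then show "\<exists>v \<in> W. card {u \<in> W. (u, v) \<in> E \<or> (v, u) \<in> E} < n"
        by (intro psubset.prems(2)) auto
    qed
    then obtain c :: "'a \<Rightarrow> nat" where c: "\<And>u. u \<in> V - {v} \<Longrightarrow> c u < n"
      "\<And>u w. u \<in> V - {v} \<Longrightarrow> w \<in> V - {v} \<Longrightarrow> (u, w) \<in> E \<Longrightarrow> c u \<noteq> c w"
      by blast
    have fin: "finite ?N" using psubset.hyps(1) by simp
    then have "card (c ` ?N) < card {..<n}"
      using le_less_trans[OF card_image_le v(2)] by simp
    then have "\<not> {..<n} \<subseteq> c ` ?N"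
      using card_mono[of "c ` ?N" "{..<n}"] fin by auto
    then obtain a where a: "a < n" "a \<notin> c ` ?N" by blast
    have "(\<forall>u \<in> V. (c(v := a)) u < n) \<and> (\<forall>u \<in> V. \<forall>w \<in> V. (u, w) \<in> E \<longrightarrow> (c(v := a)) u \<noteq> (c(v := a)) w)"
      using a c v psubset.prems(1) by auto
    then show ?thesis by blast
  qed auto
qed

lemma sum_card_fibers:
  assumes "finite W" "R \<subseteq> W \<times> W"
  shows "(\<Sum>v \<in> W. card {u. (v, u) \<in> R}) = card R"
proof -
  have "finite {u. (v, u) \<in> R}" for v
    using assms by (auto intro: finite_subset[of _ W])
  then have "card (SIGMA v:W. {u. (v, u) \<in> R}) = (\<Sum>v \<in> W. card {u. (v, u) \<in> R})"
    using assms(1) by (intro card_SigmaI) auto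
  moreover have "(SIGMA v:W. {u. (v, u) \<in> R}) = R" using assms by auto
  ultimately show ?thesis by simp
qed

text \<open>Averaging: the out-degrees and in-degrees inside \<open>W\<close> each sum to the number
  of arcs, so degrees of at least \<open>2 * m + 1\<close> throughout would need more than
  \<open>m * card W\<close> arcs.\<close>

lemma sparse_imp_low_degree:
  assumes "finite W" "W \<noteq> {}" "card (E \<inter> W \<times> W) \<le> m * card W"
  shows "\<exists>v \<in> W. card {u \<in> W. (u, v) \<in> E \<or> (v, u) \<in> E} \<le> 2 * m"
proof (rule ccontr)
  assume "\<not> ?thesis"
  then have big: "2 * m + 1 \<le> card {u \<in> W. (u, v) \<in> E \<or> (v, u) \<in> E}" if "v \<in> W" for v
    using that by fastforce
  let ?R = "E \<inter> W \<times> W"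
  have "(2 * m + 1) * card W = (\<Sum>v \<in> W. 2 * m + 1)" by simp
  also have "\<dots> \<le> (\<Sum>v \<in> W. card {u. (v, u) \<in> ?R} + card {u. (v, u) \<in> ?R\<inverse>})"
  proof (rule sum_mono)
    fix v assume v: "v \<in> W"
    have "{u \<in> W. (u, v) \<in> E \<or> (v, u) \<in> E} = {u. (v, u) \<in> ?R} \<union> {u. (v, u) \<in> ?R\<inverse>}"
      using v by auto
    then show "2 * m + 1 \<le> card {u. (v, u) \<in> ?R} + card {u. (v, u) \<in> ?R\<inverse>}"
      using big[OF v] card_Un_le[of "{u. (v, u) \<in> ?R}" "{u. (v, u) \<in> ?R\<inverse>}"] by simp
  qed
  also have "\<dots> = card ?R + card (?R\<inverse>)"
    unfolding sum.distrib using assms(1) by (intro arg_cong2[of _ _ _ _ "(+)"] sum_card_fibers) auto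
  also have "\<dots> \<le> 2 * m * card W" using assms(3) by simp
  finally show False using assms(1,2) by (simp add: card_gt_0_iff)
qed

text \<open>At each head \<open>f\<close> the arc from a tail \<open>g f\<close> of least level is
  deleted. This costs at most one arc per vertex, and the deleted arc at \<open>f\<close> is the
  companion promised to each arc that survives there.\<close>

lemma prune_min_in_arcs:
  fixes lev :: "'a \<Rightarrow> nat"
  assumes "finite W" "R \<subseteq> W \<times> W"
  obtains R' where "R' \<subseteq> R" "card R \<le> card W + card R'"
    "\<And>e f. (e, f) \<in> R' \<Longrightarrow> \<exists>p. (p, f) \<in> R \<and> p \<noteq> e \<and> lev p \<le> lev e"
proof -
  have "\<exists>p. (p, f) \<in> R \<and> (\<forall>e. (e, f) \<in> R \<longrightarrow> lev p \<le> lev e)" if "f \<in> snd ` R" for f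
    using that ex_has_least_nat[of "\<lambda>p. (p, f) \<in> R" _ lev] by auto
  then obtain g where g: "\<And>f. f \<in> snd ` R \<Longrightarrow> (g f, f) \<in> R"
    "\<And>e f. (e, f) \<in> R \<Longrightarrow> lev (g f) \<le> lev e"
    by (metis snd_conv image_eqI)
  let ?R' = "{(e, f) \<in> R. e \<noteq> g f}"
  have fin: "finite R" using assms finite_subset by blast
  have "inj_on snd (R - ?R')" by (auto simp: inj_on_def)
  moreover have "snd ` (R - ?R') \<subseteq> W" using assms by auto
  ultimately have "card (R - ?R') \<le> card W" using assms(1) by (rule card_inj_on_le)
  moreover have "card R = card (R - ?R') + card ?R'"
  proof -
    have "R \<inter> ?R' = ?R'" by auto
    then show ?thesis using card_Int_Diff[OF fin, of ?R'] by simp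
  qed
  ultimately show thesis
    using that[of ?R'] g by (force simp: image_iff)
qed

text \<open>After two prunings each surviving arc \<open>(e, f)\<close> has two further tails at
  \<open>f\<close>, with distinct levels below that of \<open>e\<close>. Two surviving arcs with the
  same tail \<open>e\<close> would then yield the forbidden configuration, so the survivors number
  at most \<open>card W\<close>; the prunings account for the other two thirds of the bound.\<close>

lemma sparse_if_no_common_tail:
  fixes lev :: "'a \<Rightarrow> nat"
  assumes W: "finite W" "R \<subseteq> W \<times> W"
    and inj: "\<And>e e' f. (e, f) \<in> R \<Longrightarrow> (e', f) \<in> R \<Longrightarrow> lev e = lev e' \<Longrightarrow> e = e'"
    and forb: "\<And>e f f' p p'. (e, f) \<in> R \<Longrightarrow> (e, f') \<in> R \<Longrightarrow> f \<noteq> f' \<Longrightarrow> (p, f) \<in> R \<Longrightarrow> (p', f') \<in> R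
      \<Longrightarrow> lev p < lev p' \<Longrightarrow> lev p' < lev e \<Longrightarrow> False"
  shows "card R \<le> 3 * card W"
proof -
  obtain R1 where R1: "R1 \<subseteq> R" "card R \<le> card W + card R1"
    "\<And>e f. (e, f) \<in> R1 \<Longrightarrow> \<exists>p. (p, f) \<in> R \<and> p \<noteq> e \<and> lev p \<le> lev e"
    using prune_min_in_arcs[OF W] by blast
  obtain R2 where R2: "R2 \<subseteq> R1" "card R1 \<le> card W + card R2"
    "\<And>e f. (e, f) \<in> R2 \<Longrightarrow> \<exists>p. (p, f) \<in> R1 \<and> p \<noteq> e \<and> lev p \<le> lev e"
    using prune_min_in_arcs[OF W(1), of R1] R1(1) W(2) by blast
  have two: "\<exists>p q. (p, f) \<in> R \<and> (q, f) \<in> R \<and> lev p < lev q \<and> lev q < lev e" if "(e, f) \<in> R2" for e f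
  proof -
    from R2(3)[OF that] obtain q where q: "(q, f) \<in> R1" "q \<noteq> e" "lev q \<le> lev e" by blast
    from R1(3)[OF q(1)] obtain p where p: "(p, f) \<in> R" "p \<noteq> q" "lev p \<le> lev q" by blast
    show ?thesis
      using p q inj[of p f q] inj[of q f e] that R1(1) R2(1) by (metis le_neq_implies_less subsetD)
  qed
  have "f = f'" if ef: "(e, f) \<in> R2" "(e, f') \<in> R2" for e f f'
  proof (rule ccontr)
    assume ne: "f \<noteq> f'"
    have R: "(e, f) \<in> R" "(e, f') \<in> R" using ef R1 R2 by auto
    obtain p q where pq: "(p, f) \<in> R" "(q, f) \<in> R" "lev p < lev q" "lev q < lev e"
      using two ef by blast
    obtain p' q' where pq': "(p', f') \<in> R" "(q', f') \<in> R" "lev p' < lev q'" "lev q' < lev e"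
      using two ef by blast
    \<comment> \<open>If the lowest tails \<open>p\<close> and \<open>p'\<close> have equal levels,
      the second tail \<open>q'\<close> at \<open>f'\<close> lies strictly above \<open>p\<close>
      and takes the place of \<open>p'\<close>.\<close>
    consider "lev p < lev p'" | "lev p' < lev p" | "lev p < lev q'" using pq' by linarith
    then show False
    proof cases
      case 1 then show ?thesis using forb[OF R ne pq(1) pq'(1)] pq' by simp
    next
      case 2 then show ?thesis using forb[OF R(2,1) not_sym[OF ne] pq'(1) pq(1)] pq by simp
    next
      case 3 then show ?thesis using forb[OF R ne pq(1) pq'(2)] pq' by simp
    qed
  qed
  then have "inj_on fst R2" by (auto simp: inj_on_def)
  moreover have "fst ` R2 \<subseteq> W"
  proof -
    have "R2 \<subseteq> W \<times> W" using R2(1) R1(1) W(2) by blast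
    then show ?thesis by auto
  qed
  ultimately have "card R2 \<le> card W" using W(1) by (rule card_inj_on_le)
  with R1 R2 show ?thesis by simp
qed

text \<open>One pruning at heads, then one at tails by passing to the converse relation. A surviving
  arc \<open>(x', y')\<close> would have both a second tail \<open>x\<close> at \<open>y'\<close>
  and a second head \<open>y\<close> at \<open>x'\<close>, neither of them higher than the vertex it
  replaces; this is the forbidden path, so nothing survives.\<close>

lemma sparse_if_no_low_P4:
  fixes lev :: "'a \<Rightarrow> nat"
  assumes W: "finite W" "R \<subseteq> W \<times> W"
    and forb: "\<And>x x' y y'. (x', y') \<in> R \<Longrightarrow> (x, y') \<in> R \<Longrightarrow> (x', y) \<in> R \<Longrightarrow> x \<noteq> x' \<Longrightarrow> y \<noteq> y'
      \<Longrightarrow> lev x \<le> lev x' \<Longrightarrow> lev y \<le> lev y' \<Longrightarrow> False"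
  shows "card R \<le> 2 * card W"
proof -
  obtain R1 where R1: "R1 \<subseteq> R" "card R \<le> card W + card R1"
    "\<And>e f. (e, f) \<in> R1 \<Longrightarrow> \<exists>p. (p, f) \<in> R \<and> p \<noteq> e \<and> lev p \<le> lev e"
    using prune_min_in_arcs[OF W] by blast
  have "R1\<inverse> \<subseteq> W \<times> W" using R1 W by auto
  then obtain R2 where R2: "R2 \<subseteq> R1\<inverse>" "card (R1\<inverse>) \<le> card W + card R2"
    "\<And>e f. (e, f) \<in> R2 \<Longrightarrow> \<exists>p. (p, f) \<in> R1\<inverse> \<and> p \<noteq> e \<and> lev p \<le> lev e"
    using prune_min_in_arcs[OF W(1), of "R1\<inverse>"] by blast
  have "R2 = {}"
  proof (rule ccontr)
    assume "R2 \<noteq> {}"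
    then obtain x' y' where *: "(y', x') \<in> R2" by auto
    then have **: "(x', y') \<in> R1" using R2 by auto
    from R2(3)[OF *] R1(3)[OF **] show False using ** R1(1) forb by blast
  qed
  with R1 R2 show ?thesis by simp
qed

section \<open>Spanning trees with levels\<close>

text \<open>A spanning out-tree encoded by its parent function, which turns moving a subtree into a
  function update. The level equation makes \<open>lev\<close> the depth and excludes cycles of
  \<open>par\<close>.\<close>

locale leveled_tree =
  fixes V :: "'a set" and A :: "'a rel" and r :: 'a and par :: "'a \<Rightarrow> 'a" and lev :: "'a \<Rightarrow> nat"
  assumes finite_V: "finite V" and root: "r \<in> V" and lev_root: "lev r = 0"
    and par_in_V: "v \<in> V \<Longrightarrow> v \<noteq> r \<Longrightarrow> par v \<in> V"
    and par_arc: "v \<in> V \<Longrightarrow> v \<noteq> r \<Longrightarrow> (par v, v) \<in> A"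
    and lev_par: "v \<in> V \<Longrightarrow> v \<noteq> r \<Longrightarrow> lev v = Suc (lev (par v))"
begin

text \<open>The bound on \<open>n\<close> stops the iteration at the root, where the value of
  \<open>par\<close> is arbitrary.\<close>

definition anc :: "'a \<Rightarrow> 'a \<Rightarrow> bool" where
  "anc u v \<longleftrightarrow> (\<exists>n \<le> lev v. u = (par ^^ n) v)"

section \<open>Ancestors, tree paths and meets\<close>

lemma funpow_par:
  assumes "v \<in> V" "n \<le> lev v"
  shows "(par ^^ n) v \<in> V" "lev ((par ^^ n) v) = lev v - n"
proof -
  have "(par ^^ n) v \<in> V \<and> lev ((par ^^ n) v) = lev v - n"
    using assms(2)
  proof (induction n)
    case (Suc n)
    then have "(par ^^ n) v \<in> V" "lev ((par ^^ n) v) = lev v - n" by auto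
    moreover with Suc.prems lev_root have "(par ^^ n) v \<noteq> r" by auto
    ultimately show ?case using par_in_V[of "(par ^^ n) v"] lev_par[of "(par ^^ n) v"] by simp
  qed (use assms in simp)
  then show "(par ^^ n) v \<in> V" "lev ((par ^^ n) v) = lev v - n" by auto
qed

lemma anc_refl [simp]: "anc v v"
  unfolding anc_def by (rule exI[of _ 0]) simp

lemma ancD:
  assumes "anc u v" "v \<in> V"
  shows "u \<in> V" "lev u \<le> lev v" "u = (par ^^ (lev v - lev u)) v"
  using assms funpow_par[of v] unfolding anc_def by auto

lemma anc_trans:
  assumes "anc u v" "anc v w" "w \<in> V"
  shows "anc u w"
proof -
  have v: "v \<in> V" using ancD assms by blast
  have "u = (par ^^ (lev v - lev u + (lev w - lev v))) w"
    using ancD(3)[OF assms(1) v] ancD(3)[OF assms(2,3)] by (simp add: funpow_add)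
  moreover have "lev v - lev u + (lev w - lev v) \<le> lev w" using ancD(2)[OF assms(2,3)] by simp
  ultimately show ?thesis unfolding anc_def by blast
qed

lemma anc_linear:
  assumes "anc u w" "anc v w" "w \<in> V" "lev u \<le> lev v"
  shows "anc u v"
proof -
  have "lev w - lev u = (lev v - lev u) + (lev w - lev v)"
    using assms(4) ancD(2)[OF assms(2,3)] by simp
  then have "u = (par ^^ (lev v - lev u)) v"
    using ancD(3)[OF assms(1,3)] ancD(3)[OF assms(2,3)] by (metis comp_apply funpow_add)
  then show ?thesis unfolding anc_def by (metis diff_le_self)
qed

lemma anc_lev_eq:
  assumes "anc u v" "v \<in> V" "lev u = lev v"
  shows "u = v"
  using ancD(3)[OF assms(1,2)] assms(3) by simp

lemma anc_par_iff:
  assumes "v \<in> V" "v \<noteq> r"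
  shows "anc u v \<longleftrightarrow> u = v \<or> anc u (par v)"
proof
  assume "anc u v"
  then obtain n where n: "n \<le> lev v" "u = (par ^^ n) v" unfolding anc_def by blast
  show "u = v \<or> anc u (par v)"
  proof (cases n)
    case (Suc m)
    with n lev_par[OF assms] have "m \<le> lev (par v)" "u = (par ^^ m) (par v)"
      by (simp_all add: funpow_swap1)
    then show ?thesis unfolding anc_def by blast
  qed (use n in simp)
next
  have "anc (par v) v"
    unfolding anc_def using lev_par[OF assms] by (intro exI[of _ 1]) simp
  moreover assume "u = v \<or> anc u (par v)"
  ultimately show "anc u v" using anc_trans assms by auto
qed

lemma lev_0: "v \<in> V \<Longrightarrow> lev v = 0 \<Longrightarrow> v = r"
  using lev_par by fastforce

lemma root_anc:
  assumes "v \<in> V"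
  shows "anc r v"
proof -
  have "(par ^^ lev v) v = r" using lev_0 funpow_par[OF assms, of "lev v"] by simp
  then show ?thesis unfolding anc_def by blast
qed

text \<open>The ancestors of \<open>v\<close> have pairwise distinct levels, which gives
  \<open>lev v + 1\<close> different vertices. This bounds the sum of levels that is maximized
  later.\<close>

lemma lev_less_card:
  assumes "v \<in> V"
  shows "lev v < card V"
proof -
  have "inj_on (\<lambda>n. (par ^^ n) v) {..lev v}"
    by (rule inj_onI) (metis assms atMost_iff diff_diff_cancel funpow_par(2))
  moreover have "(\<lambda>n. (par ^^ n) v) ` {..lev v} \<subseteq> V" using funpow_par[OF assms] by auto
  ultimately have "card {..lev v} \<le> card V" using finite_V by (rule card_inj_on_le)
  then show ?thesis by simp
qed

text \<open>Induction on the level difference, appending \<open>v\<close> to the path that ends at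
  its parent. Describing the vertices as an interval of the ancestor order reduces later
  disjointness claims to ancestor relations.\<close>

lemma tree_path:
  assumes "v \<in> V" "anc u v"
  obtains p where "dpath A u p v" "length p = Suc (lev v - lev u)"
    "set p = {w. anc u w \<and> anc w v}"
proof -
  have "\<exists>p. dpath A u p v \<and> length p = Suc (lev v - lev u) \<and> set p = {w. anc u w \<and> anc w v}"
    using assms
  proof (induction "lev v - lev u" arbitrary: v)
    case 0
    then have "u = v" using anc_lev_eq ancD(2) by (metis diff_is_0_eq le_antisym)
    moreover have "w = v" if "anc v w" "anc w v" for w
      using that 0 ancD anc_lev_eq by (metis le_antisym)
    ultimately show ?case by (intro exI[of _ "[v]"]) (auto simp: dpath_def)
  next
    case (Suc n)
    then have v: "v \<noteq> r" using lev_root by auto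
    have u: "anc u (par v)" using Suc.prems Suc.hyps(2) anc_par_iff[OF _ v] by auto
    have n: "n = lev (par v) - lev u" using Suc lev_par[OF _ v] by simp
    obtain p where p: "dpath A u p (par v)" "length p = Suc (lev (par v) - lev u)"
      "set p = {w. anc u w \<and> anc w (par v)}"
      using Suc.hyps(1)[OF n par_in_V[OF Suc.prems(1) v] u] by blast
    have "v \<notin> set p"
      using p(3) ancD(2)[of v "par v"] par_in_V[OF Suc.prems(1) v] lev_par[OF Suc.prems(1) v] by auto
    then have "dpath A u (p @ [v]) v"
      using p(1) par_arc[OF Suc.prems(1) v] by (auto simp: dpath_def vwalk_arcs_append)
    moreover have "length (p @ [v]) = Suc (lev v - lev u)" using p(2) Suc.hyps(2) n by simp
    moreover have "set (p @ [v]) = {w. anc u w \<and> anc w v}"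
      using p(3) anc_par_iff[OF Suc.prems(1) v] Suc.prems(2) by auto
    ultimately show ?case by blast
  qed
  then show thesis using that by blast
qed

text \<open>A common ancestor of greatest level works: the root is a candidate, levels are bounded
  by that of \<open>x\<close>, and the ancestors of \<open>x\<close> form a chain.\<close>

lemma meet:
  assumes "x \<in> V" "y \<in> V"
  obtains z where "anc z x" "anc z y" "\<And>w. anc w x \<Longrightarrow> anc w y \<Longrightarrow> anc w z"
proof -
  have "\<exists>z. (anc z x \<and> anc z y) \<and> (\<forall>w. anc w x \<and> anc w y \<longrightarrow> lev w \<le> lev z)"
    using root_anc assms ancD(2)[OF _ assms(1)]
    by (intro ex_has_greatest_nat[where b = "Suc (lev x)" and k = r]) (auto simp: less_Suc_eq_le)
  then show thesis using that anc_linear assms by blast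
qed

text \<open>The subtree at \<open>y\<close> is moved below \<open>x\<close>, which lies outside it,
  so no cycle arises. All levels in the subtree rise by the same positive amount, chosen so that
  \<open>y\<close> lands one level below its new parent in the tree.\<close>

lemma reattach:
  assumes "x \<in> V" "y \<in> V" "(x, y) \<in> A" "\<not> anc y x" "lev y \<le> lev x"
  defines "lev' \<equiv> \<lambda>v. if anc y v then lev v + (lev x + 1 - lev y) else lev v"
  shows "leveled_tree V A r (par(y := x)) lev'" "(\<Sum>v \<in> V. lev v) < (\<Sum>v \<in> V. lev' v)"
proof -
  have y: "y \<noteq> r" using assms root_anc by auto
  have nr: "\<not> anc y r" using ancD(2)[of y r] root lev_root lev_0[OF assms(2)] y by force
  show "leveled_tree V A r (par(y := x)) lev'"
  proof (unfold_locales, goal_cases)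
    \<comment> \<open>This is the level equation. A vertex other than \<open>y\<close> and its
      parent are both inside or both outside the moved subtree, so their level difference is
      kept.\<close>
    case (6 v)
    show ?case
    proof (cases "v = y")
      case True
      then show ?thesis using assms(4,5) by (simp add: lev'_def)
    next
      case False
      then show ?thesis using anc_par_iff[OF 6, of y] lev_par[OF 6] by (simp add: lev'_def)
    qed
  qed (use finite_V root lev_root assms(1,3) par_in_V par_arc nr in \<open>simp_all add: lev'_def\<close>)
  show "(\<Sum>v \<in> V. lev v) < (\<Sum>v \<in> V. lev' v)"
    by (rule sum_strict_mono_ex1) (use finite_V assms in \<open>auto simp: lev'_def intro!: bexI[of _ y]\<close>)
qed

end

text \<open>Breadth-first search: the level is the distance from \<open>r\<close>, and a parent is
  the last vertex before \<open>v\<close> on a shortest walk. It provides a starting point for the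
  maximization.\<close>

lemma exists_leveled_tree:
  assumes "finite V" "r \<in> V" "A \<subseteq> V \<times> V" "\<And>v. v \<in> V \<Longrightarrow> (r, v) \<in> A\<^sup>*"
  shows "\<exists>par lev. leveled_tree V A r par lev"
proof -
  define lev where "lev v = (LEAST n. (r, v) \<in> A ^^ n)" for v
  have lev: "(r, v) \<in> A ^^ lev v" if "v \<in> V" for v
    unfolding lev_def using assms(4)[OF that] by (metis LeastI rtrancl_imp_relpow)
  have lev_le: "lev v \<le> n" if "(r, v) \<in> A ^^ n" for v n
    unfolding lev_def using that by (rule Least_le)
  have "\<exists>u. (u, v) \<in> A \<and> lev v = Suc (lev u)" if v: "v \<in> V" "v \<noteq> r" for v
  proof -
    obtain n where n: "lev v = Suc n"
      using lev[OF v(1)] v(2) by (cases "lev v") auto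
    with lev[OF v(1)] obtain u where u: "(r, u) \<in> A ^^ n" "(u, v) \<in> A" by auto
    \<comment> \<open>A shortest walk to \<open>u\<close> followed by the arc to \<open>v\<close>
      gives one inequality; the initial part of a shortest walk to \<open>v\<close> gives the
      other.\<close>
    have "(r, u) \<in> A ^^ lev u" using lev u(2) assms(3) by auto
    then have "lev v \<le> Suc (lev u)" using u(2) by (intro lev_le) auto
    with lev_le[OF u(1)] n u(2) show ?thesis by (intro exI[of _ u]) simp
  qed
  then obtain par where "\<And>v. v \<in> V \<Longrightarrow> v \<noteq> r \<Longrightarrow> (par v, v) \<in> A \<and> lev v = Suc (lev (par v))"
    by metis
  moreover have "lev r = 0" using lev_le[of r 0] by simp
  ultimately have "leveled_tree V A r par lev"
    using assms by unfold_locales auto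
  then show ?thesis by blast
qed

lemma exists_maximal_leveled_tree:
  assumes "finite V" "r \<in> V" "A \<subseteq> V \<times> V" "\<And>v. v \<in> V \<Longrightarrow> (r, v) \<in> A\<^sup>*"
  obtains par lev where "leveled_tree V A r par lev"
    "\<And>x y. (x, y) \<in> A \<Longrightarrow> lev x < lev y \<or> leveled_tree.anc par lev y x"
proof -
  let ?P = "\<lambda>t. leveled_tree V A r (fst t) (snd t)"
  let ?f = "\<lambda>t :: ('a \<Rightarrow> 'a) \<times> ('a \<Rightarrow> nat). \<Sum>v \<in> V. snd t v"
  obtain par0 lev0 where "leveled_tree V A r par0 lev0"
    using exists_leveled_tree[OF assms] by blast
  \<comment> \<open>Each level is below \<open>card V\<close>, so the sum of levels has a bound
    independent of the tree and a maximum is attained.\<close>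
  moreover have "?f t < Suc (card V * card V)" if "?P t" for t
  proof -
    have "?f t \<le> (\<Sum>v \<in> V. card V)"
      using leveled_tree.lev_less_card[OF that] by (intro sum_mono) (simp add: less_imp_le)
    then show ?thesis by simp
  qed
  ultimately obtain t where t: "?P t" "\<And>s. ?P s \<Longrightarrow> ?f s \<le> ?f t"
    using ex_has_greatest_nat[of ?P "(par0, lev0)" ?f "Suc (card V * card V)"] by auto
  interpret leveled_tree V A r "fst t" "snd t" by (rule t(1))
  have "snd t x < snd t y \<or> anc y x" if "(x, y) \<in> A" for x y
  proof (rule ccontr)
    assume "\<not> ?thesis"
    then have "\<not> anc y x" "snd t y \<le> snd t x" by auto
    moreover have "x \<in> V" "y \<in> V" using that assms(3) by auto
    ultimately have "leveled_tree V A r ((fst t)(y := x)) lev'" "?f t < (\<Sum>v \<in> V. lev' v)"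
      if "lev' = (\<lambda>v. if anc y v then snd t v + (snd t x + 1 - snd t y) else snd t v)" for lev'
      using reattach[of x y] \<open>(x, y) \<in> A\<close> that by blast+
    then show False using t(2)[of "(_, _)"] by fastforce
  qed
  then show thesis using that t(1) by blast
qed

section \<open>Counting arcs within a level class\<close>

text \<open>\<open>W\<close> is any set of vertices with congruent levels rather than a full residue
  class, because degeneracy needs the arc count for every subset of a class.\<close>

locale cycle_free_level_class = leveled_tree "pverts D" "parcs D" r par lev
  for D :: "'a pair_pre_digraph" and r par lev +
  fixes k :: nat and W :: "'a set"
  assumes wf: "pair_wf_digraph D" and k: "k \<ge> 1"
    and cycle_free: "\<not> contains_subdivision D (four_block_cycle k 1 1 1)"
    and W: "W \<subseteq> pverts D" and lev_mod: "\<And>u v. u \<in> W \<Longrightarrow> v \<in> W \<Longrightarrow> lev u mod k = lev v mod k"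
begin

section \<open>Levels and ancestors inside the class\<close>

lemma finite_W: "finite W"
  using W finite_V finite_subset by blast

text \<open>Congruent levels that differ do so by a positive multiple of \<open>k\<close>; this is
  what makes a tree path long enough for the block of length \<open>k\<close>.\<close>

lemma lev_gap:
  assumes "u \<in> W" "v \<in> W" "lev u < lev v"
  shows "lev u + k \<le> lev v"
proof -
  have "k dvd lev v - lev u"
    using lev_mod[OF assms(2,1)] assms(3) by (simp add: mod_eq_dvd_iff_nat)
  then show ?thesis using assms(3) dvd_imp_le[of k "lev v - lev u"] by simp
qed

lemma anc_lev_less:
  assumes "anc u v" "v \<in> W" "u \<noteq> v"
  shows "lev u < lev v"
proof -
  have "v \<in> pverts D" using assms(2) W by blast
  then show ?thesis using ancD(2)[OF assms(1)] anc_lev_eq[OF assms(1)] assms(3) by fastforce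
qed

lemma anc_unique_lev:
  assumes "anc u w" "anc v w" "w \<in> W" "lev u = lev v"
  shows "u = v"
proof -
  have w: "w \<in> pverts D" using assms(3) W by blast
  show ?thesis
    using anc_linear[OF assms(1,2) w] anc_lev_eq[of u v] ancD(1)[OF assms(2) w] assms(4) by simp
qed

text \<open>Both \<open>p\<close> and \<open>p'\<close> turn out to be ancestors of
  \<open>e\<close>, hence lie on one branch. The level bound on the path keeps it clear of
  \<open>e\<close>, \<open>f\<close> and \<open>f'\<close>.\<close>

lemma common_ancestor_path:
  assumes "anc p f" "anc e f" "f \<in> W" "anc p' f'" "anc e f'" "f' \<in> W" "p \<in> W" "p' \<in> W"
    and lev: "lev p < lev p'" "lev p' < lev e"
  obtains P where "dpath (parcs D) p P p'" "length P > k"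
    "\<And>w. w \<in> set P \<Longrightarrow> lev w \<le> lev p'"
proof -
  have V: "f \<in> pverts D" "f' \<in> pverts D" "p' \<in> pverts D" using assms W by auto
  have "anc p e" using anc_linear[OF assms(1,2) V(1)] lev by simp
  moreover have "anc p' e" using anc_linear[OF assms(4,5) V(2)] lev by simp
  ultimately have "anc p p'"
    using lev(1) ancD(1)[OF assms(2) V(1)] by (intro anc_linear[of p e p']) auto
  then obtain P where P: "dpath (parcs D) p P p'" "length P = Suc (lev p' - lev p)"
    "set P = {w. anc p w \<and> anc w p'}"
    using tree_path[OF V(3)] by blast
  moreover have "length P > k" using P(2) lev_gap[OF assms(7,8) lev(1)] by simp
  moreover have "lev w \<le> lev p'" if "w \<in> set P" for w using that P(3) ancD(2) V(3) by blast
  ultimately show thesis using that by blast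
qed

text \<open>The forbidden configuration closes up to a cycle with long block \<open>p\<close> to
  \<open>p'\<close> along the tree and then to \<open>f'\<close>; the other blocks are the arcs from
  \<open>e\<close> to \<open>f'\<close>, from \<open>e\<close> to \<open>f\<close> and from
  \<open>p\<close> to \<open>f\<close>. Tails at a common head are ancestors of it, so equal levels
  force equality.\<close>

lemma card_forward_arcs:
  "card {(x, y) \<in> parcs D. x \<in> W \<and> y \<in> W \<and> x \<noteq> y \<and> anc x y} \<le> 3 * card W" (is "card ?R \<le> _")
proof (rule sparse_if_no_common_tail[where lev = lev])
  fix e f f' p p'
  assume R: "(e, f) \<in> ?R" "(e, f') \<in> ?R" "(p, f) \<in> ?R" "(p', f') \<in> ?R" and ne: "f \<noteq> f'"
    and lev: "lev p < lev p'" "lev p' < lev e"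
  obtain P where P: "dpath (parcs D) p P p'" "length P > k" "\<And>w. w \<in> set P \<Longrightarrow> lev w \<le> lev p'"
    using common_ancestor_path[of p f e p' f'] R lev by blast
  have l: "lev e < lev f" "lev e < lev f'" using anc_lev_less R by auto
  have nP: "e \<notin> set P" "f \<notin> set P" "f' \<notin> set P" using P(3) lev l by fastforce+
  have "contains_subdivision D (four_block_cycle k 1 1 1)"
  proof (rule contains_four_block_cycle[OF wf k])
    show "dpath (parcs D) p (P @ [f']) f'" using dpath_snoc[OF P(1)] R nP by blast
    show "dpath (parcs D) e [e, f'] f'" "dpath (parcs D) e [e, f] f" "dpath (parcs D) p [p, f] f"
      using R by (auto intro: dpath_arc)
    show "set (P @ [f']) \<inter> set [e, f'] \<subseteq> {f'}" "set (P @ [f']) \<inter> set [p, f] \<subseteq> {p}"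
      "set (P @ [f']) \<inter> set [e, f] = {}" using nP l lev ne R by auto
  qed (use P(2) lev l ne R in auto)
  with cycle_free show False by blast
qed (use finite_W in \<open>auto intro: anc_unique_lev\<close>)

text \<open>Pairs are reversed so that the ancestor again comes first and the same counting lemma
  applies. Now the long block goes from \<open>f\<close> to \<open>p\<close> and along the tree to
  \<open>p'\<close>; the other blocks are the arcs from \<open>f'\<close> to \<open>p'\<close>, from
  \<open>f'\<close> to \<open>e\<close> and from \<open>f\<close> to \<open>e\<close>.\<close>

lemma card_backward_arcs:
  "card {(y, x). (x, y) \<in> parcs D \<and> x \<in> W \<and> y \<in> W \<and> x \<noteq> y \<and> anc y x} \<le> 3 * card W"
  (is "card ?R \<le> _")
proof (rule sparse_if_no_common_tail[where lev = lev])
  fix e f f' p p'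
  assume R: "(e, f) \<in> ?R" "(e, f') \<in> ?R" "(p, f) \<in> ?R" "(p', f') \<in> ?R" and ne: "f \<noteq> f'"
    and lev: "lev p < lev p'" "lev p' < lev e"
  obtain P where P: "dpath (parcs D) p P p'" "length P > k" "\<And>w. w \<in> set P \<Longrightarrow> lev w \<le> lev p'"
    using common_ancestor_path[of p f e p' f'] R lev by blast
  have l: "lev e < lev f" "lev e < lev f'" using anc_lev_less R by auto
  have nP: "e \<notin> set P" "f \<notin> set P" "f' \<notin> set P" using P(3) lev l by fastforce+
  have "contains_subdivision D (four_block_cycle k 1 1 1)"
  proof (rule contains_four_block_cycle[OF wf k])
    show "dpath (parcs D) f (f # P) p'" using dpath_Cons[OF P(1)] R nP by blast
    show "dpath (parcs D) f' [f', p'] p'" "dpath (parcs D) f' [f', e] e" "dpath (parcs D) f [f, e] e"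
      using R by (auto intro: dpath_arc)
    show "set (f # P) \<inter> set [f', p'] \<subseteq> {p'}" "set (f # P) \<inter> set [f, e] \<subseteq> {f}"
      "set (f # P) \<inter> set [f', e] = {}" using nP l lev ne R by auto
  qed (use P(2) lev l ne R in auto)
  with cycle_free show False by blast
qed (use finite_W in \<open>auto intro: anc_unique_lev\<close>)

text \<open>With \<open>z\<close> the meet of \<open>x\<close> and \<open>y\<close>, the forbidden
  path closes up: the long block is the tree path from \<open>z\<close> to \<open>y\<close>, and the
  tree path from \<open>z\<close> to \<open>x\<close> followed by the arc to \<open>y'\<close> is
  the opposite side. The remaining blocks are the arcs from \<open>x'\<close> to \<open>y\<close>
  and to \<open>y'\<close>.\<close>

lemma card_cross_arcs:
  "card {(x, y) \<in> parcs D. x \<in> W \<and> y \<in> W \<and> lev x < lev y \<and> \<not> anc x y} \<le> 2 * card W"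
  (is "card ?R \<le> _")
proof (rule sparse_if_no_low_P4[where lev = lev])
  fix x x' y y'
  assume R: "(x', y') \<in> ?R" "(x, y') \<in> ?R" "(x', y) \<in> ?R" and ne: "x \<noteq> x'" "y \<noteq> y'"
    and lev: "lev x \<le> lev x'" "lev y \<le> lev y'"
  have V: "x \<in> pverts D" "y \<in> pverts D" using R W by auto
  obtain z where z: "anc z x" "anc z y" "\<And>w. anc w x \<Longrightarrow> anc w y \<Longrightarrow> anc w z" using meet[OF V] by blast
  obtain P where P: "dpath (parcs D) z P y" "length P = Suc (lev y - lev z)"
    "set P = {w. anc z w \<and> anc w y}"
    by (rule tree_path[OF V(2) z(2)])
  obtain Q where Q: "dpath (parcs D) z Q x" "length Q = Suc (lev x - lev z)"
    "set Q = {w. anc z w \<and> anc w x}"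
    by (rule tree_path[OF V(1) z(1)])
  have zx: "lev z \<le> lev x" using ancD(2)[OF z(1) V(1)] .
  have gap: "lev x' + k \<le> lev y" "lev x' < lev y'" using R lev_gap by auto
  \<comment> \<open>A vertex on both paths is a common ancestor of \<open>x\<close> and
    \<open>y\<close>, hence above or equal to the meet \<open>z\<close>, but it is also a descendant
    of \<open>z\<close>.\<close>
  have PQ: "w = z" if "w \<in> set P" "w \<in> set Q" for w
  proof -
    have w: "anc w x" "anc w z" "anc z w" using that P(3) Q(3) z(3) by auto
    note inV = ancD(1)[OF w(1) V(1)] ancD(1)[OF z(1) V(1)]
    show ?thesis
      using ancD(2)[OF w(2) inV(2)] ancD(2)[OF w(3) inV(1)] anc_lev_eq[OF w(2) inV(2)] by simp
  qed
  \<comment> \<open>\<open>x'\<close> is no ancestor of \<open>y\<close> because the arc from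
    \<open>x'\<close> to \<open>y\<close> is a cross arc; \<open>y'\<close> is none because its
    level is at least that of \<open>y\<close>.\<close>
  have nP: "x' \<notin> set P" "y' \<notin> set P"
    using P(3) R ne(2) lev(2) anc_lev_less[of y' y] by auto
  have nQ: "x' \<notin> set Q" "y' \<notin> set Q" "y \<notin> set Q"
    using Q(3) R ne(1) lev gap k anc_lev_less[of x' x] ancD(2)[OF _ V(1)] by fastforce+
  have zs: "z \<in> set P" "z \<in> set Q" "y \<in> set P" using dpathD(2,3)[OF P(1)] dpathD(2)[OF Q(1)] by auto
  have "contains_subdivision D (four_block_cycle k 1 1 1)"
  proof (rule contains_four_block_cycle[OF wf k])
    show "dpath (parcs D) z P y" by (rule P(1))
    show "dpath (parcs D) x' [x', y] y" "dpath (parcs D) x' [x', y'] y'"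
      using R by (auto intro: dpath_arc)
    show "dpath (parcs D) z (Q @ [y']) y'" using dpath_snoc[OF Q(1)] R nQ by blast
    \<comment> \<open>The levels satisfy \<open>lev z \<le> lev x\<close>,
      \<open>lev x \<le> lev x'\<close> and \<open>lev x' + k \<le> lev y\<close>.\<close>
    show "length P > k" using P(2) zx lev gap by simp
    show "set P \<inter> set [x', y] \<subseteq> {y}" "set [x', y'] \<inter> set (Q @ [y']) \<subseteq> {y'}"
      "set P \<inter> set (Q @ [y']) \<subseteq> {z}" "set P \<inter> set [x', y'] = {}"
      "set [x', y] \<inter> set (Q @ [y']) = {}" "set [x', y] \<inter> set [x', y'] \<subseteq> {x'}"
      using nP nQ PQ ne gap k by auto
    show "z \<noteq> x'" "z \<noteq> y" "z \<noteq> y'" using zs nP nQ by auto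
  qed (use ne gap k in auto)
  with cycle_free show False by blast
qed (use finite_W in auto)

text \<open>The hypothesis is the dichotomy from the maximal tree. It sorts every arc into one of
  the three kinds, whence 3 + 3 + 2.\<close>

lemma card_arcs:
  assumes "\<And>x y. (x, y) \<in> parcs D \<Longrightarrow> x \<noteq> y \<and> (lev x < lev y \<or> anc y x)"
  shows "card (parcs D \<inter> W \<times> W) \<le> 8 * card W"
proof -
  let ?F = "{(x, y) \<in> parcs D. x \<in> W \<and> y \<in> W \<and> x \<noteq> y \<and> anc x y}"
  let ?B = "{(y, x). (x, y) \<in> parcs D \<and> x \<in> W \<and> y \<in> W \<and> x \<noteq> y \<and> anc y x}"
  let ?C = "{(x, y) \<in> parcs D. x \<in> W \<and> y \<in> W \<and> lev x < lev y \<and> \<not> anc x y}"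
  have "finite (W \<times> W)" using finite_W by simp
  then have "finite (?F \<union> ?B\<inverse> \<union> ?C)" by (rule finite_subset[rotated]) auto
  moreover have "parcs D \<inter> W \<times> W \<subseteq> ?F \<union> ?B\<inverse> \<union> ?C" using assms by auto
  ultimately have "card (parcs D \<inter> W \<times> W) \<le> card (?F \<union> ?B\<inverse> \<union> ?C)" by (rule card_mono)
  also have "\<dots> \<le> card ?F + card (?B\<inverse>) + card ?C"
    using card_Un_le[of "?F \<union> ?B\<inverse>" ?C] card_Un_le[of ?F "?B\<inverse>"] by linarith
  also have "\<dots> \<le> 8 * card W"
    unfolding card_inverse using card_forward_arcs card_backward_arcs card_cross_arcs by linarith
  finally show ?thesis .
qed

end

section \<open>Combining the colourings of the residue classes\<close>

theorem theorem2p1: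
  fixes D :: "'a pair_pre_digraph" and k :: nat
  assumes "k \<ge> 1"
    and "oriented_graph D"
    and "has_spanning_out_tree D"
    and "\<not> contains_subdivision D (four_block_cycle k 1 1 1)"
  shows "digraph_chromatic_number D \<le> 18 * k"
proof -
  interpret oriented_graph D by fact
  let ?V = "pverts D" and ?A = "parcs D"
  obtain T r where T: "spanning (with_proj T) (with_proj D)" "out_tree T r"
    using assms(3) unfolding has_spanning_out_tree_def by blast
  have sub: "pverts T = ?V" "parcs T \<subseteq> ?A" using T(1) by (auto simp: spanning_def subgraph_def)
  \<comment> \<open>The paths of the out-tree show that every vertex is reachable from
    \<open>r\<close>, which is what the construction of a maximal tree starts from.\<close>
  have reach: "(r, v) \<in> ?A\<^sup>*" if "v \<in> ?V" for v
  proof -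
    have "\<exists>!p. pre_digraph.apath T r p v"
      using T(2) that sub(1) by (simp add: out_tree_def)
    then obtain p where "pre_digraph.apath T r p v" by (rule ex1E)
    then have "pcas r p v" "set p \<subseteq> ?A"
      using sub(2) by (auto simp: pre_digraph.apath_def pre_digraph.awalk_def cas_with_proj_eq)
    then show ?thesis by (rule pcas_imp_rtrancl)
  qed
  have "r \<in> ?V" using T(2) sub(1) by (simp add: out_tree_def)
  moreover have "?A \<subseteq> ?V \<times> ?V" by (auto dest: wellformed')
  ultimately obtain par lev where tree: "leveled_tree ?V ?A r par lev"
    and max: "\<And>x y. (x, y) \<in> ?A \<Longrightarrow> lev x < lev y \<or> leveled_tree.anc par lev y x"
    using exists_maximal_leveled_tree[OF pair_finite_verts _ _ reach] by metis
  let ?L = "\<lambda>i. {v \<in> ?V. lev v mod k = i}"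
  let ?proper = "\<lambda>i c. (\<forall>v \<in> ?L i. c v < 18) \<and> (\<forall>u \<in> ?L i. \<forall>v \<in> ?L i. (u, v) \<in> ?A \<longrightarrow> c u \<noteq> c v)"
  have "\<exists>c :: 'a \<Rightarrow> nat. ?proper i c" for i
  proof (rule degenerate_coloring)
    fix U assume U: "U \<subseteq> ?L i" "U \<noteq> {}"
    interpret leveled_tree ?V ?A r par lev by (rule tree)
    interpret cycle_free_level_class D r par lev k U
      using assms(1,4) U pair_wf_digraph by unfold_locales auto
    have "card (?A \<inter> U \<times> U) \<le> 8 * card U"
      using card_arcs max no_loops' by blast
    \<comment> \<open>At most \<open>8 * card U\<close> arcs inside \<open>U\<close> give a vertex
      with at most 16 neighbours there, fewer than the 18 colours.\<close>
    then obtain v where "v \<in> U" "card {u \<in> U. (u, v) \<in> ?A \<or> (v, u) \<in> ?A} \<le> 2 * 8"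
      using sparse_imp_low_degree[OF finite_W U(2)] by blast
    then show "\<exists>v \<in> U. card {u \<in> U. (u, v) \<in> ?A \<or> (v, u) \<in> ?A} < 18"
      by (intro bexI[of _ v]) simp_all
  qed (use pair_finite_verts no_loops' in auto)
  then have "\<exists>c :: nat \<Rightarrow> 'a \<Rightarrow> nat. \<forall>i. ?proper i (c i)"
    by (intro choice allI)
  then obtain c :: "nat \<Rightarrow> 'a \<Rightarrow> nat" where c: "\<And>i. ?proper i (c i)" by blast
  have c_less: "c (lev v mod k) v < 18" if "v \<in> ?V" for v
    using c[of "lev v mod k"] that by simp
  have c_neq: "c (lev u mod k) u \<noteq> c (lev v mod k) v" if "(u, v) \<in> ?A" "lev u mod k = lev v mod k" for u v
    using c[of "lev v mod k"] that wellformed'[OF that(1)] by simp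
  \<comment> \<open>Each residue class receives its own block of 18 consecutive colours. Division by
    18 recovers the class and the remainder recovers the colour within it.\<close>
  define col where "col v = c (lev v mod k) v + 18 * (lev v mod k)" for v
  have div: "col v div 18 = lev v mod k" "col v mod 18 = c (lev v mod k) v" if "v \<in> ?V" for v
    using c_less[OF that] by (simp_all add: col_def)
  have "col v < 18 * k" if "v \<in> ?V" for v
  proof -
    have "lev v mod k + 1 \<le> k" using assms(1) by (simp add: Suc_leI)
    then show ?thesis using c_less[OF that] unfolding col_def by linarith
  qed
  moreover have "col u \<noteq> col v" if "(u, v) \<in> ?A" for u v
    using div c_neq[OF that] wellformed'[OF that] by metis
  ultimately have "proper_coloring (mk_symmetric D) (18 * k) col"
    by (fastforce simp: proper_coloring_def mk_symmetric_def)
  then show ?thesis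
    unfolding digraph_chromatic_number_def chromatic_number_def by (intro Least_le exI)
qed

end
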